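(* Let $x_{\text{jopt}}$ be the job-optimal relaxed unsplit stable assignment and $x_{\text{mopt}}$ the machine-optimal relaxed unsplit stable assignment of an instance (both exist). Then for every relaxed unsplit stable assignment $x$ of the instance, \[ |x_{\text{mopt}}| \le |x| \le |x_{\text{jopt}}|, \] i.e. among all relaxed unsplit stable assignments, $|x|$ is maximized at $x_{\text{jopt}}$ and minimized at $x_{\text{mopt}}$.
   Context: An instance consists of a finite bipartite graph $G=(J\cup M,E)$ between a set $J$ of jobs and a set $M$ of machines; each job $j$ has a size $q(j)>0$ and each machine $m$ a capacity $q(m)>0$. Every job has a strict preference order over its incident edges (equivalently, adjacent machines) and every machine has a strict preference order over its incident edges (adjacent jobs). $M$ contains a dummy machine $m_d$ that is adjacent to every job, is ranked last by every job, and has capacity $q(m_d)>\sum_{j\in J}q(j)$. An assignment is a function $x:E\to\mathbb{R}_{\ge 0}$; write $x(j)=\sum_{m}x(jm)$ and $x(m)=\sum_j x(jm)$. An assignment is unsplit if $x(jm)\in\{0,q(j)\}$ for all $jm\in E$ and $x(j)\le q(j)$ for every job (so each job is assigned entirely to at most one machine). An unsplit assignment $x$ is a relaxed unsplit assignment if for every machine $m$ to which at least one job is assigned, $x(m)-q(j_m)<q(m)$, where $j_m$ is the job assigned to $m$ that $m$ likes least. A relaxed unsplit assignment $x$ is stable if for every edge $jm$ with $x(jm)=0$, either $j$ is assigned to a machine it prefers to $m$, or $\sum_{j' : m \text{ prefers } j' \text{ to } j} x(j'm)\ge q(m)$. The size is $|x|=\sum_{jm\in E,\, m\neq m_d}x(jm)$.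 Comparisons: for unsplit assignments $x_1,x_2$, a job $j$ weakly prefers $x_1$ to $x_2$ if the machine $j$ is assigned to in $x_1$ is equal to or preferred by $j$ to its machine in $x_2$; a machine $m$ weakly prefers $x_1$ to $x_2$ if either no edge incident to $m$ is positive in exactly one of $x_1,x_2$, or the edge that $m$ ranks best among the edges incident to $m$ that are positive in exactly one of $x_1,x_2$ is positive in $x_1$ (lexicographic order). A relaxed unsplit stable assignment is job-optimal (resp. machine-optimal) if every job (resp. machine) weakly prefers it to every relaxed unsplit stable assignment; it is job-pessimal (resp. machine-pessimal) if every job (resp. machine) weakly prefers every relaxed unsplit stable assignment to it. It is known that a job-optimal relaxed unsplit stable assignment exists. *)

theory Defs
  imports Complex_Main "HOL-Library.FuncSet"
begin

text \<open>
  A pair in \<open>job_pref I j\<close> (or \<open>mach_pref I m\<close>) has the preferred element first. As jobs and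
  machines have separate types, an edge is a pair and its two sides cannot overlap.
\<close>

record ('j, 'm) alloc_inst =
  jobs      :: "'j set"
  machines  :: "'m set"
  edges     :: "('j \<times> 'm) set"
  job_size  :: "'j \<Rightarrow> real"
  capacity  :: "'m \<Rightarrow> real"
  job_pref  :: "'j \<Rightarrow> 'm rel"
  mach_pref :: "'m \<Rightarrow> 'j rel"
  dummy     :: "'m"

definition job_nbrs :: "('j, 'm) alloc_inst \<Rightarrow> 'j \<Rightarrow> 'm set" where
  "job_nbrs I j = {m. (j, m) \<in> edges I}"

definition mach_nbrs :: "('j, 'm) alloc_inst \<Rightarrow> 'm \<Rightarrow> 'j set" where
  "mach_nbrs I m = {j. (j, m) \<in> edges I}"

definition strict_preference_on :: "'a set \<Rightarrow> 'a rel \<Rightarrow> bool" where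
  "strict_preference_on A r \<longleftrightarrow> r \<subseteq> A \<times> A \<and> strict_linear_order_on A r"

definition valid_inst :: "('j, 'm) alloc_inst \<Rightarrow> bool" where
  "valid_inst I \<longleftrightarrow>
     finite (jobs I) \<and> finite (machines I) \<and> edges I \<subseteq> jobs I \<times> machines I \<and>
     (\<forall>j\<in>jobs I. job_size I j > 0) \<and> (\<forall>m\<in>machines I. capacity I m > 0) \<and>
     (\<forall>j\<in>jobs I. strict_preference_on (job_nbrs I j) (job_pref I j)) \<and>
     (\<forall>m\<in>machines I. strict_preference_on (mach_nbrs I m) (mach_pref I m)) \<and>
     dummy I \<in> machines I \<and>
     (\<forall>j\<in>jobs I. (j, dummy I) \<in> edges I) \<and>
     (\<forall>j\<in>jobs I. \<forall>m\<in>job_nbrs I j. m \<noteq> dummy I \<longrightarrow> (m, dummy I) \<in> job_pref I j) \<and>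
     capacity I (dummy I) > (\<Sum>j\<in>jobs I. job_size I j)"

definition assignment :: "('j, 'm) alloc_inst \<Rightarrow> ('j \<times> 'm \<Rightarrow> real) \<Rightarrow> bool" where
  "assignment I x \<longleftrightarrow> x \<in> edges I \<rightarrow>\<^sub>E {0..}"

definition job_load :: "('j, 'm) alloc_inst \<Rightarrow> ('j \<times> 'm \<Rightarrow> real) \<Rightarrow> 'j \<Rightarrow> real" where
  "job_load I x j = (\<Sum>m\<in>job_nbrs I j. x (j, m))"

definition mach_load :: "('j, 'm) alloc_inst \<Rightarrow> ('j \<times> 'm \<Rightarrow> real) \<Rightarrow> 'm \<Rightarrow> real" where
  "mach_load I x m = (\<Sum>j\<in>mach_nbrs I m. x (j, m))"

definition assigned :: "('j, 'm) alloc_inst \<Rightarrow> ('j \<times> 'm \<Rightarrow> real) \<Rightarrow> 'j \<Rightarrow> 'm \<Rightarrow> bool" where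
  "assigned I x j m \<longleftrightarrow> (j, m) \<in> edges I \<and> x (j, m) > 0"

definition unsplit :: "('j, 'm) alloc_inst \<Rightarrow> ('j \<times> 'm \<Rightarrow> real) \<Rightarrow> bool" where
  "unsplit I x \<longleftrightarrow> assignment I x \<and>
     (\<forall>(j, m)\<in>edges I. x (j, m) \<in> {0, job_size I j}) \<and>
     (\<forall>j\<in>jobs I. job_load I x j \<le> job_size I j)"

definition least_liked :: "('j, 'm) alloc_inst \<Rightarrow> ('j \<times> 'm \<Rightarrow> real) \<Rightarrow> 'm \<Rightarrow> 'j \<Rightarrow> bool" where
  "least_liked I x m j \<longleftrightarrow> assigned I x j m \<and>
     (\<forall>j'. assigned I x j' m \<and> j' \<noteq> j \<longrightarrow> (j', j) \<in> mach_pref I m)"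

definition relaxed_unsplit :: "('j, 'm) alloc_inst \<Rightarrow> ('j \<times> 'm \<Rightarrow> real) \<Rightarrow> bool" where
  "relaxed_unsplit I x \<longleftrightarrow> unsplit I x \<and>
     (\<forall>m\<in>machines I. \<forall>j. least_liked I x m j \<longrightarrow> mach_load I x m - job_size I j < capacity I m)"

definition stable_relaxed_unsplit :: "('j, 'm) alloc_inst \<Rightarrow> ('j \<times> 'm \<Rightarrow> real) \<Rightarrow> bool" where
  "stable_relaxed_unsplit I x \<longleftrightarrow> relaxed_unsplit I x \<and>
     (\<forall>(j, m)\<in>edges I. x (j, m) = 0 \<longrightarrow>
        (\<exists>m'. assigned I x j m' \<and> (m', m) \<in> job_pref I j) \<or>
        (\<Sum>j' | j' \<in> mach_nbrs I m \<and> (j', j) \<in> mach_pref I m. x (j', m)) \<ge> capacity I m)"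

definition assignment_size :: "('j, 'm) alloc_inst \<Rightarrow> ('j \<times> 'm \<Rightarrow> real) \<Rightarrow> real" where
  "assignment_size I x = (\<Sum>e | e \<in> edges I \<and> snd e \<noteq> dummy I. x e)"

text \<open>
  The comparison of jobs is false if \<open>j\<close> is unassigned in \<open>x1\<close> or \<open>x2\<close>. It is only applied to
  stable assignments, and these assign every job because of the dummy machine.
\<close>

definition job_weakly_prefers ::
  "('j, 'm) alloc_inst \<Rightarrow> 'j \<Rightarrow> ('j \<times> 'm \<Rightarrow> real) \<Rightarrow> ('j \<times> 'm \<Rightarrow> real) \<Rightarrow> bool" where
  "job_weakly_prefers I j x1 x2 \<longleftrightarrow>
     (\<exists>m1 m2. assigned I x1 j m1 \<and> assigned I x2 j m2 \<and>
        (m1 = m2 \<or> (m1, m2) \<in> job_pref I j))"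

definition mach_diff ::
  "('j, 'm) alloc_inst \<Rightarrow> 'm \<Rightarrow> ('j \<times> 'm \<Rightarrow> real) \<Rightarrow> ('j \<times> 'm \<Rightarrow> real) \<Rightarrow> 'j set" where
  "mach_diff I m x1 x2 = {j \<in> mach_nbrs I m. assigned I x1 j m \<noteq> assigned I x2 j m}"

definition mach_weakly_prefers ::
  "('j, 'm) alloc_inst \<Rightarrow> 'm \<Rightarrow> ('j \<times> 'm \<Rightarrow> real) \<Rightarrow> ('j \<times> 'm \<Rightarrow> real) \<Rightarrow> bool" where
  "mach_weakly_prefers I m x1 x2 \<longleftrightarrow>
     mach_diff I m x1 x2 = {} \<or>
     (\<exists>j\<in>mach_diff I m x1 x2.
        (\<forall>j'\<in>mach_diff I m x1 x2. j' \<noteq> j \<longrightarrow> (j, j') \<in> mach_pref I m) \<and> assigned I x1 j m)"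

definition job_optimal :: "('j, 'm) alloc_inst \<Rightarrow> ('j \<times> 'm \<Rightarrow> real) \<Rightarrow> bool" where
  "job_optimal I x \<longleftrightarrow> stable_relaxed_unsplit I x \<and>
     (\<forall>y. stable_relaxed_unsplit I y \<longrightarrow> (\<forall>j\<in>jobs I. job_weakly_prefers I j x y))"

definition machine_optimal :: "('j, 'm) alloc_inst \<Rightarrow> ('j \<times> 'm \<Rightarrow> real) \<Rightarrow> bool" where
  "machine_optimal I x \<longleftrightarrow> stable_relaxed_unsplit I x \<and>
     (\<forall>y. stable_relaxed_unsplit I y \<longrightarrow> (\<forall>m\<in>machines I. mach_weakly_prefers I m x y))"

end

theory Submission
  imports Defs
begin

text \<open>
  On edge sets, relaxed unsplit stable assignments are the stable matchings for the choice functions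
  in which a machine accepts jobs in order of preference until its capacity is reached. Given a set
  \<open>P\<close> of proposals, let every job propose exactly along the edges all of whose better alternatives
  are rejected from \<open>P\<close>. This map is monotone: its fixed points yield stable assignments, and every
  stable assignment comes from a fixed point. The least fixed point is thus best for all jobs and
  the greatest one is worst for all jobs. The worst one for jobs is lexicographically best for the
  machines. Since the dummy machine is last for every job, an assignment that is weakly better for
  all jobs leaves fewer jobs on the dummy machine, which gives the inequalities between sizes.
\<close>

text \<open>Induction on \<open>S\<close>: a new element either loses to the current best one or, by
  totality, beats it and then by transitivity beats everything else. Pairs have the preferred
  element first, so applying this to the converse order yields a least liked element.\<close>

lemma strict_order_best_exists:
  assumes "trans r" "total_on A r" "finite S" "S \<noteq> {}" "S \<subseteq> A"
  shows "\<exists>x\<in>S. \<forall>y\<in>S. y \<noteq> x \<longrightarrow> (x, y) \<in> r"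
  using assms(3-5)
proof (induction S rule: finite_ne_induct)
  case (singleton x)
  then show ?case by simp
next
  case (insert a S)
  then obtain x where x: "x \<in> S" "\<forall>y\<in>S. y \<noteq> x \<longrightarrow> (x, y) \<in> r" by auto
  show ?case
  proof (cases "(x, a) \<in> r")
    case True
    then show ?thesis using x by auto
  next
    case False
    then have ax: "(a, x) \<in> r"
      using assms(2) x(1) insert by (auto simp: total_on_def)
    have "(a, y) \<in> r" if "y \<in> S" for y
      using x ax that transD[OF assms(1) ax] by (cases "y = x") auto
    then show ?thesis by auto
  qed
qed

section \<open>Edge sets, stability of edge sets and the proposal map\<close>

definition support :: "('j, 'm) alloc_inst \<Rightarrow> ('j \<times> 'm \<Rightarrow> real) \<Rightarrow> ('j \<times> 'm) set" where
  "support I x = {(j, m). assigned I x j m}"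

text \<open>Inverse of \<open>support\<close> on unsplit assignments. The restriction matches the
  extensional function space in \<open>assignment\<close>, so that the two maps are inverse as
  functions and not only on edges.\<close>

definition unsplit_of :: "('j, 'm) alloc_inst \<Rightarrow> ('j \<times> 'm) set \<Rightarrow> 'j \<times> 'm \<Rightarrow> real" where
  "unsplit_of I A = restrict (\<lambda>e. if e \<in> A then job_size I (fst e) else 0) (edges I)"

text \<open>\<open>A\<close> need not be a matching: the same quantity serves for sets of proposals,
  in which a job may occur at several machines.\<close>

definition better_load :: "('j, 'm) alloc_inst \<Rightarrow> ('j \<times> 'm) set \<Rightarrow> 'j \<Rightarrow> 'm \<Rightarrow> real" where
  "better_load I A j m = (\<Sum>j' | (j', m) \<in> A \<and> (j', j) \<in> mach_pref I m. job_size I j')"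

text \<open>The relaxed capacity bound is required at every job of \<open>A\<close> instead of only
  at the least liked one. This is equivalent, because the better load grows as the job gets
  worse.\<close>

definition stable_edges :: "('j, 'm) alloc_inst \<Rightarrow> ('j \<times> 'm) set \<Rightarrow> bool" where
  "stable_edges I A \<longleftrightarrow> A \<subseteq> edges I \<and>
     (\<forall>j m m'. (j, m) \<in> A \<longrightarrow> (j, m') \<in> A \<longrightarrow> m = m') \<and>
     (\<forall>j m. (j, m) \<in> A \<longrightarrow> better_load I A j m < capacity I m) \<and>
     (\<forall>j m. (j, m) \<in> edges I \<longrightarrow> (j, m) \<notin> A \<longrightarrow>
        (\<exists>m'. (j, m') \<in> A \<and> (m', m) \<in> job_pref I j) \<or> capacity I m \<le> better_load I A j m)"

text \<open>A machine keeps a job as long as the better proposals leave some capacity, so the last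
  job kept may exceed it. Since \<open>P\<close> later ranges over all sets of pairs, the edge
  condition ensures that \<open>m\<close> is a machine of the instance.\<close>

definition rejected :: "('j, 'm) alloc_inst \<Rightarrow> ('j \<times> 'm) set \<Rightarrow> ('j \<times> 'm) set" where
  "rejected I P = {(j, m). (j, m) \<in> P \<and> (j, m) \<in> edges I \<and> capacity I m \<le> better_load I P j m}"

definition proposals :: "('j, 'm) alloc_inst \<Rightarrow> ('j \<times> 'm) set \<Rightarrow> ('j \<times> 'm) set" where
  "proposals I P =
     {(j, m). (j, m) \<in> edges I \<and> (\<forall>m'. (m', m) \<in> job_pref I j \<longrightarrow> (j, m') \<in> rejected I P)}"

text \<open>Vacuous for a job that is missing from \<open>A\<close> or \<open>B\<close>; stable sets
  miss no job.\<close>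

definition jobs_weakly_prefer ::
  "('j, 'm) alloc_inst \<Rightarrow> ('j \<times> 'm) set \<Rightarrow> ('j \<times> 'm) set \<Rightarrow> bool" where
  "jobs_weakly_prefer I A B \<longleftrightarrow>
     (\<forall>j m m'. (j, m) \<in> A \<longrightarrow> (j, m') \<in> B \<longrightarrow> m = m' \<or> (m, m') \<in> job_pref I j)"

section \<open>Elementary properties of a valid instance\<close>

locale allocation =
  fixes I :: "('j, 'm) alloc_inst"
  assumes valid: "valid_inst I"
begin

lemma finite_jobs: "finite (jobs I)" and finite_machines: "finite (machines I)"
  and edges_subset: "edges I \<subseteq> jobs I \<times> machines I"
  using valid by (auto simp: valid_inst_def)

lemma edgeD: "(j, m) \<in> edges I \<Longrightarrow> j \<in> jobs I" "(j, m) \<in> edges I \<Longrightarrow> m \<in> machines I"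
  using edges_subset by auto

lemma finite_edges: "finite (edges I)"
  using edges_subset finite_jobs finite_machines by (meson finite_SigmaI finite_subset)

lemma finite_job_nbrs: "finite (job_nbrs I j)"
  by (rule finite_subset[OF _ finite_machines]) (auto simp: job_nbrs_def dest: edgeD)

lemma finite_mach_nbrs: "finite (mach_nbrs I m)"
  by (rule finite_subset[OF _ finite_jobs]) (auto simp: mach_nbrs_def dest: edgeD)

lemma size_pos: "j \<in> jobs I \<Longrightarrow> job_size I j > 0"
  using valid by (auto simp: valid_inst_def)

lemma dummy_edge: "j \<in> jobs I \<Longrightarrow> (j, dummy I) \<in> edges I"
  using valid by (auto simp: valid_inst_def)

lemma dummy_last: "(j, m) \<in> edges I \<Longrightarrow> m \<noteq> dummy I \<Longrightarrow> (m, dummy I) \<in> job_pref I j"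
  using valid edgeD by (force simp: valid_inst_def job_nbrs_def)

lemma job_pref:
  assumes "j \<in> jobs I"
  shows job_pref_trans: "trans (job_pref I j)"
    and job_pref_irrefl: "(m, m) \<notin> job_pref I j"
    and job_pref_total: "total_on (job_nbrs I j) (job_pref I j)"
    and job_pref_edge: "(m, m') \<in> job_pref I j \<Longrightarrow> (j, m) \<in> edges I \<and> (j, m') \<in> edges I"
  using valid assms
  by (auto simp: valid_inst_def strict_preference_on_def strict_linear_order_on_def irrefl_def
      job_nbrs_def)

lemma mach_pref:
  assumes "m \<in> machines I"
  shows mach_pref_trans: "trans (mach_pref I m)"
    and mach_pref_irrefl: "(j, j) \<notin> mach_pref I m"
    and mach_pref_total: "total_on (mach_nbrs I m) (mach_pref I m)"
    and mach_pref_edge: "(j, j') \<in> mach_pref I m \<Longrightarrow> (j, m) \<in> edges I \<and> (j', m) \<in> edges I"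
  using valid assms
  by (auto simp: valid_inst_def strict_preference_on_def strict_linear_order_on_def irrefl_def
      mach_nbrs_def)

lemma job_pref_asym: "j \<in> jobs I \<Longrightarrow> (m, m') \<in> job_pref I j \<Longrightarrow> (m', m) \<notin> job_pref I j"
  using transD[OF job_pref_trans] job_pref_irrefl by blast

lemma mach_pref_asym: "m \<in> machines I \<Longrightarrow> (j, j') \<in> mach_pref I m \<Longrightarrow> (j', j) \<notin> mach_pref I m"
  using transD[OF mach_pref_trans] mach_pref_irrefl by blast

lemma finite_better: "m \<in> machines I \<Longrightarrow> finite {j'. (j', m) \<in> A \<and> (j', j) \<in> mach_pref I m}"
  by (rule finite_subset[OF _ finite_mach_nbrs[of m]])
    (auto simp: mach_nbrs_def dest: mach_pref_edge)

text \<open>Sizes are positive, so a larger index set has a larger sum. Varying both the set and the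
  job covers enlarging the set of proposals, passing to a worse job, and combinations of the
  two.\<close>

lemma better_load_mono:
  assumes m: "m \<in> machines I"
    and sub: "\<And>i. (i, m) \<in> A \<Longrightarrow> (i, j) \<in> mach_pref I m \<Longrightarrow> (i, m) \<in> B \<and> (i, j') \<in> mach_pref I m"
  shows "better_load I A j m \<le> better_load I B j' m"
  unfolding better_load_def
proof (rule sum_mono2[OF finite_better[OF m]])
  fix i assume "i \<in> {i. (i, m) \<in> B \<and> (i, j') \<in> mach_pref I m} -
      {i. (i, m) \<in> A \<and> (i, j) \<in> mach_pref I m}"
  then show "0 \<le> job_size I i"
    using size_pos edgeD mach_pref_edge[OF m] by (force intro: less_imp_le)
qed (use sub in auto)

text \<open>The jobs counted lie in \<open>jobs I\<close>, whose total size is below the capacity of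
  the dummy machine. Hence that machine never fills up and rejects nobody.\<close>

lemma better_load_dummy_less:
  assumes "j \<in> jobs I"
  shows "better_load I A j (dummy I) < capacity I (dummy I)"
proof -
  have m: "dummy I \<in> machines I" using dummy_edge[OF assms] edgeD by auto
  have "better_load I A j (dummy I) \<le> (\<Sum>j\<in>jobs I. job_size I j)"
    unfolding better_load_def
    by (rule sum_mono2[OF finite_jobs])
      (auto dest: edgeD mach_pref_edge[OF m] size_pos intro: less_imp_le)
  then show ?thesis using valid by (auto simp: valid_inst_def)
qed

subsection \<open>Assignments as edge sets\<close>

lemma support_unsplit_of: "A \<subseteq> edges I \<Longrightarrow> support I (unsplit_of I A) = A"
  by (auto simp: support_def assigned_def unsplit_of_def size_pos dest: edgeD split: if_splits)

lemma support_subset: "support I x \<subseteq> edges I"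
  by (auto simp: support_def assigned_def)

lemma unsplit_value:
  assumes "unsplit I x"
  shows unsplit_support: "(j, m) \<in> support I x \<Longrightarrow> x (j, m) = job_size I j"
    and unsplit_not_support: "(j, m) \<in> edges I \<Longrightarrow> (j, m) \<notin> support I x \<Longrightarrow> x (j, m) = 0"
proof -
  have "x (j, m) \<in> {0, job_size I j}" if "(j, m) \<in> edges I"
    using assms that by (auto simp: unsplit_def)
  then show "(j, m) \<in> support I x \<Longrightarrow> x (j, m) = job_size I j"
    and "(j, m) \<in> edges I \<Longrightarrow> (j, m) \<notin> support I x \<Longrightarrow> x (j, m) = 0"
    using size_pos edgeD(1)[of j m] by (auto simp: support_def assigned_def)
qed

lemma unsplit_of_support:
  assumes "unsplit I x"
  shows "unsplit_of I (support I x) = x"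
proof
  fix e :: "'j \<times> 'm"
  obtain j m where e: "e = (j, m)" by (cases e)
  have "x \<in> extensional (edges I)" using assms by (auto simp: unsplit_def assignment_def PiE_def)
  then show "unsplit_of I (support I x) e = x e"
    using unsplit_value[OF assms, of j m] by (auto simp: e unsplit_of_def extensional_def)
qed

lemma sum_better_eq:
  assumes "unsplit I x" "m \<in> machines I"
  shows "(\<Sum>j' | j' \<in> mach_nbrs I m \<and> (j', j) \<in> mach_pref I m. x (j', m)) =
    better_load I (support I x) j m"
  unfolding better_load_def
proof (rule sum.mono_neutral_cong_right)
  show "finite {j' \<in> mach_nbrs I m. (j', j) \<in> mach_pref I m}"
    using finite_mach_nbrs by auto
  show "{j'. (j', m) \<in> support I x \<and> (j', j) \<in> mach_pref I m} \<subseteq>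
      {j' \<in> mach_nbrs I m. (j', j) \<in> mach_pref I m}"
    using support_subset by (auto simp: mach_nbrs_def)
qed (use unsplit_value[OF assms(1)] in \<open>auto simp: mach_nbrs_def\<close>)

text \<open>Every other job on \<open>m\<close> is preferred to \<open>j\<close>, so the jobs on
  \<open>m\<close> are \<open>j\<close> and those counted by the better load. The relaxed capacity
  condition thus becomes a bound on \<open>better_load\<close>.\<close>

lemma mach_load_least_liked:
  assumes x: "unsplit I x" and m: "m \<in> machines I" and ll: "least_liked I x m j"
  shows "mach_load I x m = job_size I j + better_load I (support I x) j m"
proof -
  let ?S = "{j'. (j', m) \<in> support I x \<and> (j', j) \<in> mach_pref I m}"
  have "mach_load I x m = (\<Sum>j'\<in>insert j ?S. job_size I j')"
    unfolding mach_load_def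
  proof (rule sum.mono_neutral_cong_right[OF finite_mach_nbrs])
    show "insert j ?S \<subseteq> mach_nbrs I m"
      using ll by (auto simp: least_liked_def support_def assigned_def mach_nbrs_def)
    show "\<forall>i\<in>mach_nbrs I m - insert j ?S. x (i, m) = 0"
      using ll unsplit_not_support[OF x, of _ m]
      by (auto simp: least_liked_def support_def mach_nbrs_def)
    show "x (i, m) = job_size I i" if "i \<in> insert j ?S" for i
      using that ll unsplit_support[OF x, of i m] by (auto simp: least_liked_def support_def)
  qed
  also have "\<dots> = job_size I j + better_load I (support I x) j m"
    unfolding better_load_def
    by (rule sum.insert[OF finite_better[OF m]]) (simp add: mach_pref_irrefl[OF m])
  finally show ?thesis .
qed

text \<open>Two machines would give \<open>j\<close> a load of at least twice its positive
  size.\<close>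

lemma unsplit_machine_unique:
  assumes x: "unsplit I x" and jm: "(j, m) \<in> support I x" "(j, m') \<in> support I x"
  shows "m = m'"
proof (rule ccontr)
  assume ne: "m \<noteq> m'"
  have e: "(j, m) \<in> edges I" "(j, m') \<in> edges I" using jm by (auto simp: support_def assigned_def)
  have j: "j \<in> jobs I" using e edgeD by auto
  have "(\<Sum>i\<in>{m, m'}. x (j, i)) \<le> job_load I x j"
    unfolding job_load_def
  proof (rule sum_mono2[OF finite_job_nbrs])
    show "0 \<le> x (j, b)" if "b \<in> job_nbrs I j - {m, m'}" for b
      using that x by (auto simp: job_nbrs_def unsplit_def assignment_def PiE_def)
  qed (use e in \<open>auto simp: job_nbrs_def\<close>)
  also have "\<dots> \<le> job_size I j" using x j by (auto simp: unsplit_def)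
  finally show False
    using ne unsplit_support[OF x jm(1)] unsplit_support[OF x jm(2)] size_pos[OF j] by auto
qed

lemma stable_edges_support:
  assumes "stable_relaxed_unsplit I x"
  shows "stable_edges I (support I x)"
proof -
  have x: "unsplit I x" and relaxed: "relaxed_unsplit I x"
    using assms by (auto simp: stable_relaxed_unsplit_def relaxed_unsplit_def)
  note sub = support_subset[of x]
  have "better_load I (support I x) j m < capacity I m" if jm: "(j, m) \<in> support I x" for j m
  proof -
    have m: "m \<in> machines I" using jm sub edgeD by auto
    let ?S = "{i. (i, m) \<in> support I x}"
    have S: "?S \<subseteq> mach_nbrs I m" using sub by (auto simp: mach_nbrs_def)
    \<comment> \<open>The best element for the converse order is the least liked job
      \<open>w\<close> on \<open>m\<close>. The bound known for \<open>w\<close> passes to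
      \<open>j\<close>, since each job of the support better than \<open>j\<close> is also better
      than \<open>w\<close>.\<close>
    have "\<exists>w\<in>?S. \<forall>y\<in>?S. y \<noteq> w \<longrightarrow> (w, y) \<in> (mach_pref I m)\<inverse>"
      using mach_pref_trans[OF m] mach_pref_total[OF m] finite_subset[OF S finite_mach_nbrs] S jm
      by (intro strict_order_best_exists[where A = "mach_nbrs I m"]) auto
    then obtain w where w: "(w, m) \<in> support I x"
      "\<And>y. (y, m) \<in> support I x \<Longrightarrow> y \<noteq> w \<Longrightarrow> (y, w) \<in> mach_pref I m"
      by auto
    then have ll: "least_liked I x m w" by (auto simp: least_liked_def support_def)
    have "better_load I (support I x) j m \<le> better_load I (support I x) w m"
    proof (rule better_load_mono[OF m])
      fix i assume i: "(i, m) \<in> support I x" "(i, j) \<in> mach_pref I m"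
      then show "(i, m) \<in> support I x \<and> (i, w) \<in> mach_pref I m"
        using w(2)[OF jm] transD[OF mach_pref_trans[OF m]] by (cases "j = w") auto
    qed
    also have "\<dots> < capacity I m"
      using relaxed ll m mach_load_least_liked[OF x m ll]
      by (fastforce simp: relaxed_unsplit_def)
    finally show ?thesis .
  qed
  moreover have "(\<exists>m'. (j, m') \<in> support I x \<and> (m', m) \<in> job_pref I j) \<or>
      capacity I m \<le> better_load I (support I x) j m"
    if "(j, m) \<in> edges I" "(j, m) \<notin> support I x" for j m
  proof -
    have "x (j, m) = 0" by (rule unsplit_not_support[OF x that])
    then show ?thesis
      using assms that(1) sum_better_eq[OF x edgeD(2)[OF that(1)], of j]
      by (fastforce simp: stable_relaxed_unsplit_def support_def)
  qed
  ultimately show ?thesis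
    using sub unsplit_machine_unique[OF x] unfolding stable_edges_def by blast
qed

lemma unsplit_unsplit_of:
  assumes sub: "A \<subseteq> edges I"
    and uniq: "\<And>j m m'. (j, m) \<in> A \<Longrightarrow> (j, m') \<in> A \<Longrightarrow> m = m'"
  shows "unsplit I (unsplit_of I A)"
proof -
  have "assignment I (unsplit_of I A)"
    using size_pos edgeD(1) by (fastforce simp: assignment_def unsplit_of_def intro: less_imp_le)
  moreover have "job_load I (unsplit_of I A) j \<le> job_size I j" if j: "j \<in> jobs I" for j
  proof -
    have "job_load I (unsplit_of I A) j = (\<Sum>m | (j, m) \<in> A. job_size I j)"
      unfolding job_load_def
      by (rule sum.mono_neutral_cong_right[OF finite_job_nbrs])
        (use sub in \<open>auto simp: job_nbrs_def unsplit_of_def\<close>)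
    also have "\<dots> \<le> job_size I j"
    proof (cases "\<exists>m. (j, m) \<in> A")
      case True
      then obtain m where "(j, m) \<in> A" by auto
      then have "{m. (j, m) \<in> A} = {m}" using uniq by auto
      then show ?thesis by simp
    next
      case False
      then show ?thesis using size_pos[OF j] by simp
    qed
    finally show ?thesis .
  qed
  ultimately show ?thesis by (auto simp: unsplit_def unsplit_of_def)
qed

text \<open>A least liked job lies in \<open>A\<close>, so its bound on the better load is exactly
  the relaxed capacity condition; stability carries over once the sum is identified with
  \<open>better_load\<close>.\<close>

lemma stable_unsplit_of:
  assumes A: "stable_edges I A"
  shows "stable_relaxed_unsplit I (unsplit_of I A)"
proof -
  let ?x = "unsplit_of I A"
  have sub: "A \<subseteq> edges I" using A by (auto simp: stable_edges_def)
  have x: "unsplit I ?x"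
    using A unfolding stable_edges_def by (intro unsplit_unsplit_of) blast+
  have s: "support I ?x = A" by (rule support_unsplit_of[OF sub])
  have as: "assigned I ?x j m \<longleftrightarrow> (j, m) \<in> A" for j m using s by (auto simp: support_def)
  have "mach_load I ?x m - job_size I j < capacity I m"
    if "m \<in> machines I" "least_liked I ?x m j" for m j
    using mach_load_least_liked[OF x that] s A as that(2)
    by (auto simp: stable_edges_def least_liked_def)
  moreover have "(\<exists>m'. assigned I ?x j m' \<and> (m', m) \<in> job_pref I j) \<or>
      (\<Sum>j' | j' \<in> mach_nbrs I m \<and> (j', j) \<in> mach_pref I m. ?x (j', m)) \<ge> capacity I m"
    if e: "(j, m) \<in> edges I" and "?x (j, m) = 0" for j m
  proof -
    have "(j, m) \<notin> A" using that as[of j m] by (auto simp: assigned_def)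
    then show ?thesis
      unfolding sum_better_eq[OF x edgeD(2)[OF e]] s as using A e by (auto simp: stable_edges_def)
  qed
  ultimately show ?thesis
    using x unfolding stable_relaxed_unsplit_def relaxed_unsplit_def by blast
qed

text \<open>Consider the dummy edge of \<open>j\<close>. If it is not in \<open>A\<close>, then
  stability provides a better machine, as the dummy machine cannot be full.\<close>

lemma stable_edges_assigns:
  assumes "stable_edges I A" "j \<in> jobs I"
  obtains m where "(j, m) \<in> A"
  using assms better_load_dummy_less[OF assms(2), of A] dummy_edge[OF assms(2)]
  unfolding stable_edges_def by (meson not_le)

lemma stable_edges_subset: "stable_edges I A \<Longrightarrow> A \<subseteq> edges I"
  and stable_edges_unique: "stable_edges I A \<Longrightarrow> (j, m) \<in> A \<Longrightarrow> (j, m') \<in> A \<Longrightarrow> m = m'"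
  and stable_edges_less: "stable_edges I A \<Longrightarrow> (j, m) \<in> A \<Longrightarrow> better_load I A j m < capacity I m"
  unfolding stable_edges_def by blast+

text \<open>The only machine of \<open>j\<close> in \<open>A\<close> is the worse machine
  \<open>m'\<close>, so of the two alternatives in stability only a full \<open>m\<close>
  remains.\<close>

lemma stable_edges_blocked:
  assumes "stable_edges I A" "(j, m) \<in> edges I" "(j, m') \<in> A" "(m, m') \<in> job_pref I j"
  shows "capacity I m \<le> better_load I A j m"
proof -
  have j: "j \<in> jobs I" using assms(2) edgeD by auto
  have "(j, m) \<notin> A"
    using stable_edges_unique[OF assms(1) _ assms(3)] assms(4) job_pref_irrefl[OF j] by blast
  moreover have "(m'', m) \<notin> job_pref I j" if "(j, m'') \<in> A" for m''
    using stable_edges_unique[OF assms(1) assms(3) that] assms(4) job_pref_asym[OF j] by blast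
  ultimately show ?thesis using assms(1,2) unfolding stable_edges_def by blast
qed

subsection \<open>Fixed points of the proposal map\<close>

text \<open>Substitutability of the machines' choice functions: additional proposals only add
  competitors, so a rejected proposal stays rejected.\<close>

lemma mono_rejected: "mono (rejected I)"
proof (rule monoI, rule subsetI)
  fix P Q :: "('j \<times> 'm) set" and e assume PQ: "P \<subseteq> Q" and "e \<in> rejected I P"
  moreover obtain j m where e: "e = (j, m)" by (cases e)
  ultimately have r: "(j, m) \<in> rejected I P" by simp
  then have "m \<in> machines I" by (auto simp: rejected_def dest: edgeD)
  then have "better_load I P j m \<le> better_load I Q j m"
    using PQ by (intro better_load_mono) auto
  then show "e \<in> rejected I Q" using r PQ by (auto simp: rejected_def e)
qed

lemma mono_proposals: "mono (proposals I)"
  using mono_rejected unfolding mono_def proposals_def by blast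

text \<open>Rejection is defined by all proposals, also the rejected ones. For the best rejected job
  \<open>i\<close> at \<open>m\<close>, however, all better proposals are accepted, and as
  \<open>i\<close> is \<open>j\<close> or better than \<open>j\<close>, they count against
  \<open>j\<close> as well.\<close>

lemma better_load_accepted:
  assumes e: "(j, m) \<in> rejected I P"
  shows "capacity I m \<le> better_load I (P - rejected I P) j m"
proof -
  have m: "m \<in> machines I" using e by (auto simp: rejected_def dest: edgeD)
  let ?S = "{i. (i, m) \<in> rejected I P}"
  have S: "?S \<subseteq> mach_nbrs I m" by (auto simp: rejected_def mach_nbrs_def)
  have "\<exists>i\<in>?S. \<forall>y\<in>?S. y \<noteq> i \<longrightarrow> (i, y) \<in> mach_pref I m"
    using finite_subset[OF S finite_mach_nbrs] e S
    by (intro strict_order_best_exists[OF mach_pref_trans[OF m] mach_pref_total[OF m]]) auto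
  then obtain i where i: "(i, m) \<in> rejected I P"
    "\<And>y. (y, m) \<in> rejected I P \<Longrightarrow> y \<noteq> i \<Longrightarrow> (i, y) \<in> mach_pref I m" by auto
  have "capacity I m \<le> better_load I P i m" using i by (auto simp: rejected_def)
  also have "\<dots> \<le> better_load I (P - rejected I P) j m"
  proof (rule better_load_mono[OF m])
    fix k assume k: "(k, m) \<in> P" "(k, i) \<in> mach_pref I m"
    have "(k, m) \<notin> rejected I P"
      using i(2)[of k] k(2) mach_pref_irrefl[OF m] mach_pref_asym[OF m] by blast
    moreover have "(k, j) \<in> mach_pref I m"
      using i(2)[OF e] k(2) transD[OF mach_pref_trans[OF m]] by (cases "j = i") auto
    ultimately show "(k, m) \<in> P - rejected I P \<and> (k, j) \<in> mach_pref I m" using k by auto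
  qed
  finally show ?thesis .
qed

lemma fixpoint_stable:
  assumes P: "proposals I P = P"
  shows "stable_edges I (P - rejected I P)"
proof -
  let ?A = "P - rejected I P"
  have memP: "(j, m) \<in> P \<longleftrightarrow>
      (j, m) \<in> edges I \<and> (\<forall>m'. (m', m) \<in> job_pref I j \<longrightarrow> (j, m') \<in> rejected I P)" for j m
    using P unfolding proposals_def by blast
  have sub: "?A \<subseteq> edges I" using memP by auto
  \<comment> \<open>The worse of two distinct machines would be proposed to only if the better one
    had rejected \<open>j\<close>.\<close>
  have uniq: "m = m'" if a: "(j, m) \<in> ?A" "(j, m') \<in> ?A" for j m m'
  proof (rule ccontr)
    assume "m \<noteq> m'"
    moreover have "m \<in> job_nbrs I j" "m' \<in> job_nbrs I j" "j \<in> jobs I"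
      using a sub by (auto simp: job_nbrs_def dest: edgeD)
    ultimately have "(m, m') \<in> job_pref I j \<or> (m', m) \<in> job_pref I j"
      using job_pref_total by (auto simp: total_on_def)
    then show False using a memP by blast
  qed
  have less: "better_load I ?A j m < capacity I m" if a: "(j, m) \<in> ?A" for j m
  proof -
    have "better_load I ?A j m \<le> better_load I P j m"
      using a sub by (intro better_load_mono) (auto dest: edgeD)
    also have "\<dots> < capacity I m" using a sub by (auto simp: rejected_def)
    finally show ?thesis .
  qed
  have stab: "(\<exists>m'. (j, m') \<in> ?A \<and> (m', m) \<in> job_pref I j) \<or> capacity I m \<le> better_load I ?A j m"
    if e: "(j, m) \<in> edges I" "(j, m) \<notin> ?A" for j m
  proof (cases "(j, m) \<in> P")
    case True
    then show ?thesis using e better_load_accepted by auto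
  next
    case False
    have j: "j \<in> jobs I" using e edgeD by auto
    \<comment> \<open>Some machine better than \<open>m\<close> does not reject \<open>j\<close>,
      since \<open>m\<close> receives no proposal. All machines better than the best such
      \<open>n\<close> reject \<open>j\<close>, so \<open>j\<close> proposes to \<open>n\<close> and
      is accepted.\<close>
    let ?S = "{m'. (m', m) \<in> job_pref I j \<and> (j, m') \<notin> rejected I P}"
    have S: "?S \<subseteq> job_nbrs I j" using job_pref_edge[OF j] by (auto simp: job_nbrs_def)
    have "?S \<noteq> {}" using False e memP by auto
    then have "\<exists>i\<in>?S. \<forall>y\<in>?S. y \<noteq> i \<longrightarrow> (i, y) \<in> job_pref I j"
      using finite_subset[OF S finite_job_nbrs] S
      by (intro strict_order_best_exists[OF job_pref_trans[OF j] job_pref_total[OF j]])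
    then obtain n where n: "(n, m) \<in> job_pref I j" "(j, n) \<notin> rejected I P"
      "\<And>y. (y, m) \<in> job_pref I j \<Longrightarrow> (j, y) \<notin> rejected I P \<Longrightarrow> y \<noteq> n \<Longrightarrow> (n, y) \<in> job_pref I j"
      by auto
    have "(j, y) \<in> rejected I P" if y: "(y, n) \<in> job_pref I j" for y
      using n(3)[of y] y transD[OF job_pref_trans[OF j] y n(1)] job_pref_irrefl[OF j]
        job_pref_asym[OF j] by blast
    then have "(j, n) \<in> P" using memP job_pref_edge[OF j n(1)] by auto
    then show ?thesis using n by auto
  qed
  show ?thesis unfolding stable_edges_def using sub uniq less stab by blast
qed

text \<open>The fixed point that belongs to a stable set \<open>A\<close>: each job proposes to its
  machine in \<open>A\<close> and to all better ones, and deleting the rejected proposals returns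
  \<open>A\<close>.\<close>

definition offers :: "('j \<times> 'm) set \<Rightarrow> ('j \<times> 'm) set" where
  "offers A = {(j, m). (j, m) \<in> edges I \<and> (\<exists>m'. (j, m') \<in> A \<and> (m = m' \<or> (m, m') \<in> job_pref I j))}"

text \<open>An offer outside \<open>A\<close> goes to a machine better than the job's own, which by
  stability is already filled with better jobs of \<open>A\<close>. An edge of \<open>A\<close>
  survives because these additional offers come from jobs that its machine likes less.\<close>

lemma rejected_offers:
  assumes A: "stable_edges I A"
  shows "rejected I (offers A) = offers A - A"
proof -
  have sub: "A \<subseteq> offers A" using stable_edges_subset[OF A] by (auto simp: offers_def)
  have "(j, m) \<in> rejected I (offers A)" if jm: "(j, m) \<in> offers A" "(j, m) \<notin> A" for j m
  proof -
    from jm obtain m' where m': "(j, m) \<in> edges I" "(j, m') \<in> A" "(m, m') \<in> job_pref I j"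
      by (auto simp: offers_def)
    have "capacity I m \<le> better_load I A j m" by (rule stable_edges_blocked[OF A m'])
    also have "\<dots> \<le> better_load I (offers A) j m"
      using sub m' by (intro better_load_mono) (auto dest: edgeD)
    finally show ?thesis using jm m' by (auto simp: rejected_def)
  qed
  moreover have "(j, m) \<notin> rejected I (offers A)" if jm: "(j, m) \<in> A" for j m
  proof -
    have m: "m \<in> machines I" using jm stable_edges_subset[OF A] edgeD by auto
    have "better_load I (offers A) j m \<le> better_load I A j m"
    proof (rule better_load_mono[OF m])
      fix i assume i: "(i, m) \<in> offers A" "(i, j) \<in> mach_pref I m"
      have "(i, m) \<in> A"
      \<comment> \<open>An offer outside \<open>A\<close> from a job \<open>i\<close> better than
        \<open>j\<close> would mean that jobs of \<open>A\<close> better than \<open>i\<close>,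
        hence better than \<open>j\<close>, fill \<open>m\<close>; but \<open>m\<close> keeps
        \<open>j\<close>.\<close>
      proof (rule ccontr)
        assume "(i, m) \<notin> A"
        with i obtain m' where m': "(i, m) \<in> edges I" "(i, m') \<in> A" "(m, m') \<in> job_pref I i"
          by (auto simp: offers_def)
        have "capacity I m \<le> better_load I A i m" by (rule stable_edges_blocked[OF A m'])
        also have "\<dots> \<le> better_load I A j m"
          using i(2) transD[OF mach_pref_trans[OF m]] by (intro better_load_mono[OF m]) auto
        finally show False using stable_edges_less[OF A jm] by simp
      qed
      then show "(i, m) \<in> A \<and> (i, j) \<in> mach_pref I m" using i by simp
    qed
    then show ?thesis using stable_edges_less[OF A jm] by (auto simp: rejected_def)
  qed
  ultimately show ?thesis by (auto simp: rejected_def)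
qed

text \<open>Let \<open>n\<close> be the machine of \<open>j\<close> in \<open>A\<close>. The
  rejected offers of \<open>j\<close> are those to machines better than \<open>n\<close>, so the
  machines all of whose better alternatives reject \<open>j\<close> are \<open>n\<close> and the
  better ones.\<close>

lemma proposals_offers:
  assumes A: "stable_edges I A"
  shows "proposals I (offers A) = offers A"
proof (rule set_eqI)
  fix e :: "'j \<times> 'm"
  obtain j m where e: "e = (j, m)" by (cases e)
  have "(j, m) \<in> proposals I (offers A) \<longleftrightarrow> (j, m) \<in> offers A"
  proof (cases "(j, m) \<in> edges I")
    case True
    then have j: "j \<in> jobs I" using edgeD by auto
    obtain n where n: "(j, n) \<in> A" using stable_edges_assigns[OF A j] .
    have off: "(j, k) \<in> offers A \<longleftrightarrow> (j, k) \<in> edges I \<and> (k = n \<or> (k, n) \<in> job_pref I j)" for k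
      unfolding offers_def using n stable_edges_unique[OF A n] by blast
    have inA: "(j, k) \<in> A \<longleftrightarrow> k = n" for k using n stable_edges_unique[OF A n] by blast
    have tot: "m = n \<or> (m, n) \<in> job_pref I j \<or> (n, m) \<in> job_pref I j"
      using job_pref_total[OF j] True n stable_edges_subset[OF A]
      by (auto simp: total_on_def job_nbrs_def)
    show ?thesis
    proof
      assume "(j, m) \<in> proposals I (offers A)"
      then have "(n, m) \<notin> job_pref I j"
        using n by (auto simp: proposals_def rejected_offers[OF A])
      then show "(j, m) \<in> offers A" using tot off True by auto
    next
      assume "(j, m) \<in> offers A"
      then have "m = n \<or> (m, n) \<in> job_pref I j" using off by auto
      then have "(j, k) \<in> offers A - A" if "(k, m) \<in> job_pref I j" for k
        using that off inA job_pref_edge[OF j that] job_pref_irrefl[OF j]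
          transD[OF job_pref_trans[OF j] that] by auto
      then show "(j, m) \<in> proposals I (offers A)"
        using True by (auto simp: proposals_def rejected_offers[OF A])
    qed
  qed (auto simp: proposals_def offers_def)
  then show "e \<in> proposals I (offers A) \<longleftrightarrow> e \<in> offers A" by (simp add: e)
qed

lemma best_stable_edges:
  "\<exists>A. stable_edges I A \<and> (\<forall>B. stable_edges I B \<longrightarrow> jobs_weakly_prefer I A B)"
proof (intro exI conjI allI impI)
  let ?P = "lfp (proposals I)"
  show "stable_edges I (?P - rejected I ?P)"
    by (rule fixpoint_stable) (rule lfp_fixpoint[OF mono_proposals])
  fix B assume B: "stable_edges I B"
  \<comment> \<open>Every accepted edge is thus an offer for \<open>B\<close>, which means that its
    machine is the one in \<open>B\<close> or a better one.\<close>
  have "?P \<subseteq> offers B" using proposals_offers[OF B] by (intro lfp_lowerbound) simp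
  then show "jobs_weakly_prefer I (?P - rejected I ?P) B"
    using stable_edges_unique[OF B] unfolding jobs_weakly_prefer_def offers_def by blast
qed

lemma worst_stable_edges:
  "\<exists>A. stable_edges I A \<and> (\<forall>B. stable_edges I B \<longrightarrow> jobs_weakly_prefer I B A)"
proof (intro exI conjI allI impI)
  let ?P = "gfp (proposals I)"
  have fp: "proposals I ?P = ?P" by (rule gfp_fixpoint[OF mono_proposals])
  show st: "stable_edges I (?P - rejected I ?P)" by (rule fixpoint_stable[OF fp])
  fix B assume B: "stable_edges I B"
  have sub: "offers B \<subseteq> ?P" using proposals_offers[OF B] by (intro gfp_upperbound) simp
  show "jobs_weakly_prefer I B (?P - rejected I ?P)"
    unfolding jobs_weakly_prefer_def
  proof (intro allI impI)
    fix j m m' assume jm: "(j, m) \<in> B" "(j, m') \<in> ?P - rejected I ?P"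
    have e: "(j, m) \<in> edges I" "(j, m') \<in> edges I"
      using jm stable_edges_subset[OF B] stable_edges_subset[OF st] by auto
    have "(j, m) \<in> ?P" using jm e sub by (auto simp: offers_def)
    then have "(j, m) \<in> proposals I ?P" using fp by simp
    \<comment> \<open>A proposal to \<open>m\<close> requires that every better machine rejects
      \<open>j\<close>, whereas \<open>m'\<close> accepts \<open>j\<close>.\<close>
    then have "(m', m) \<notin> job_pref I j" using jm by (auto simp: proposals_def)
    then show "m = m' \<or> (m, m') \<in> job_pref I j"
      using e job_pref_total[OF edgeD(1)[OF e(1)]] by (auto simp: total_on_def job_nbrs_def)
  qed
qed

subsection \<open>Optimality and size\<close>

lemma job_weakly_prefers_if:
  assumes x: "stable_relaxed_unsplit I x" and y: "stable_relaxed_unsplit I y"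
    and pref: "jobs_weakly_prefer I (support I x) (support I y)" and j: "j \<in> jobs I"
  shows "job_weakly_prefers I j x y"
proof -
  obtain m where "(j, m) \<in> support I x"
    using stable_edges_assigns[OF stable_edges_support[OF x] j] .
  moreover obtain m' where "(j, m') \<in> support I y"
    using stable_edges_assigns[OF stable_edges_support[OF y] j] .
  ultimately show ?thesis
    using pref unfolding job_weakly_prefers_def jobs_weakly_prefer_def support_def by blast
qed

lemma jobs_weakly_prefer_if:
  assumes x: "stable_relaxed_unsplit I x" and y: "stable_relaxed_unsplit I y"
    and pref: "\<And>j. j \<in> jobs I \<Longrightarrow> job_weakly_prefers I j x y"
  shows "jobs_weakly_prefer I (support I x) (support I y)"
  unfolding jobs_weakly_prefer_def
proof (intro allI impI)
  fix j m m' assume a: "(j, m) \<in> support I x" "(j, m') \<in> support I y"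
  then have "j \<in> jobs I" by (auto simp: support_def assigned_def dest: edgeD)
  then obtain n n' where n: "(j, n) \<in> support I x" "(j, n') \<in> support I y"
      "n = n' \<or> (n, n') \<in> job_pref I j"
    using pref by (force simp: job_weakly_prefers_def support_def)
  then show "m = m' \<or> (m, m') \<in> job_pref I j"
    using stable_edges_unique[OF stable_edges_support[OF x] a(1) n(1)]
      stable_edges_unique[OF stable_edges_support[OF y] a(2) n(2)] by simp
qed

section \<open>Uniqueness of the optimal assignments\<close>

lemma jobs_weakly_prefer_antisym:
  assumes A: "stable_edges I A" and B: "stable_edges I B"
    and AB: "jobs_weakly_prefer I A B" and BA: "jobs_weakly_prefer I B A"
  shows "A \<subseteq> B"
proof (rule subrelI)
  fix j m assume jm: "(j, m) \<in> A"
  then have j: "j \<in> jobs I" using stable_edges_subset[OF A] edgeD by auto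
  obtain m' where m': "(j, m') \<in> B" using stable_edges_assigns[OF B j] .
  have "m = m'"
    using AB BA jm m' job_pref_asym[OF j] unfolding jobs_weakly_prefer_def by blast
  then show "(j, m) \<in> B" using m' by simp
qed

lemma stable_eqI:
  assumes "stable_relaxed_unsplit I x" "stable_relaxed_unsplit I y" "support I x = support I y"
  shows "x = y"
  using assms unsplit_of_support
  by (metis stable_relaxed_unsplit_def relaxed_unsplit_def)

lemma job_optimal_unique:
  assumes x: "job_optimal I x" and y: "job_optimal I y"
  shows "x = y"
proof -
  have s: "stable_relaxed_unsplit I x" "stable_relaxed_unsplit I y"
    using x y by (auto simp: job_optimal_def)
  have "jobs_weakly_prefer I (support I x) (support I y)"
    "jobs_weakly_prefer I (support I y) (support I x)"
    using x y s by (auto simp: job_optimal_def intro!: jobs_weakly_prefer_if)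
  then show ?thesis
    using s by (intro stable_eqI equalityI jobs_weakly_prefer_antisym stable_edges_support)
qed

lemma machine_optimal_unique:
  assumes x: "machine_optimal I x" and y: "machine_optimal I y"
  shows "x = y"
proof -
  have s: "stable_relaxed_unsplit I x" "stable_relaxed_unsplit I y"
    using x y by (auto simp: machine_optimal_def)
  have "assigned I x j m = assigned I y j m" for j m
  proof (rule ccontr)
    assume d: "assigned I x j m \<noteq> assigned I y j m"
    then have e: "(j, m) \<in> edges I" by (auto simp: assigned_def)
    have m: "m \<in> machines I" using e edgeD by auto
    have "j \<in> mach_diff I m x y" using d e by (auto simp: mach_diff_def mach_nbrs_def)
    moreover have sym: "mach_diff I m y x = mach_diff I m x y" by (auto simp: mach_diff_def)
    moreover have "mach_weakly_prefers I m x y" "mach_weakly_prefers I m y x"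
      using x y s m by (auto simp: machine_optimal_def)
    ultimately obtain i k where
      i: "i \<in> mach_diff I m x y" "assigned I x i m"
        "\<forall>j'\<in>mach_diff I m x y. j' \<noteq> i \<longrightarrow> (i, j') \<in> mach_pref I m" and
      k: "k \<in> mach_diff I m x y" "assigned I y k m"
        "\<forall>j'\<in>mach_diff I m x y. j' \<noteq> k \<longrightarrow> (k, j') \<in> mach_pref I m"
      unfolding mach_weakly_prefers_def by auto
    \<comment> \<open>Both are the best job of the same difference set. That job would then be
      assigned to \<open>m\<close> in both assignments, so it could not lie in the
      difference.\<close>
    have "i = k"
      using bspec[OF i(3) k(1)] bspec[OF k(3) i(1)] mach_pref_asym[OF m, of i k] by auto
    then show False using i(1,2) k(2) by (auto simp: mach_diff_def)
  qed
  then have "support I x = support I y" by (auto simp: support_def)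
  then show ?thesis using s by (intro stable_eqI)
qed

text \<open>Opposition of interests. If the best job \<open>i\<close> in the difference were on
  \<open>m\<close> only in \<open>y\<close>, it would prefer \<open>m\<close> to its machine in
  \<open>x\<close>, so \<open>m\<close> would be filled in \<open>x\<close> by jobs better than
  \<open>i\<close>. These are also on \<open>m\<close> in \<open>y\<close>, where \<open>m\<close>
  then could not keep \<open>i\<close>.\<close>

lemma mach_weakly_prefers_if:
  assumes x: "stable_relaxed_unsplit I x" and y: "stable_relaxed_unsplit I y"
    and pref: "jobs_weakly_prefer I (support I y) (support I x)" and m: "m \<in> machines I"
  shows "mach_weakly_prefers I m x y"
proof (cases "mach_diff I m x y = {}")
  case True
  then show ?thesis by (simp add: mach_weakly_prefers_def)
next
  case False
  let ?D = "mach_diff I m x y"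
  have D: "?D \<subseteq> mach_nbrs I m" by (auto simp: mach_diff_def)
  have "\<exists>i\<in>?D. \<forall>k\<in>?D. k \<noteq> i \<longrightarrow> (i, k) \<in> mach_pref I m"
    using finite_subset[OF D finite_mach_nbrs] False D
    by (intro strict_order_best_exists[OF mach_pref_trans[OF m] mach_pref_total[OF m]])
  then obtain i where i: "i \<in> ?D" "\<forall>k\<in>?D. k \<noteq> i \<longrightarrow> (i, k) \<in> mach_pref I m" by auto
  have "assigned I x i m"
  proof (rule ccontr)
    assume nx: "\<not> assigned I x i m"
    then have iy: "(i, m) \<in> support I y" and ix: "(i, m) \<notin> support I x"
      using i by (auto simp: mach_diff_def support_def)
    have e: "(i, m) \<in> edges I" using iy by (auto simp: support_def assigned_def)
    obtain n where n: "(i, n) \<in> support I x"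
      using stable_edges_assigns[OF stable_edges_support[OF x] edgeD(1)[OF e]] .
    have "(m, n) \<in> job_pref I i"
      using pref iy n ix unfolding jobs_weakly_prefer_def by blast
    then have "capacity I m \<le> better_load I (support I x) i m"
      by (rule stable_edges_blocked[OF stable_edges_support[OF x] e n])
    also have "\<dots> \<le> better_load I (support I y) i m"
    proof (rule better_load_mono[OF m])
      fix k assume k: "(k, m) \<in> support I x" "(k, i) \<in> mach_pref I m"
      \<comment> \<open>As \<open>i\<close> is best in the difference, \<open>x\<close> and
        \<open>y\<close> agree at \<open>m\<close> on all jobs better than \<open>i\<close>.\<close>
      have "k \<notin> ?D"
        using i(2) k(2) mach_pref_irrefl[OF m, of i] mach_pref_asym[OF m k(2)] by auto
      then show "(k, m) \<in> support I y \<and> (k, i) \<in> mach_pref I m"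
        using k by (auto simp: mach_diff_def support_def assigned_def mach_nbrs_def)
    qed
    finally show False using stable_edges_less[OF stable_edges_support[OF y] iy] by simp
  qed
  then show ?thesis using i by (auto simp: mach_weakly_prefers_def)
qed

text \<open>Each job has one machine, so \<open>fst\<close> is injective on the support. Written
  over a set of jobs, sizes can be compared by inclusion.\<close>

lemma assignment_size_eq:
  assumes x: "stable_relaxed_unsplit I x"
  shows "assignment_size I x =
    (\<Sum>j\<in>fst ` {e \<in> support I x. snd e \<noteq> dummy I}. job_size I j)"
proof -
  have u: "unsplit I x" using x by (auto simp: stable_relaxed_unsplit_def relaxed_unsplit_def)
  have inj: "inj_on fst {e \<in> support I x. snd e \<noteq> dummy I}"
    using stable_edges_unique[OF stable_edges_support[OF x]] by (auto simp: inj_on_def)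
  have "assignment_size I x =
      (\<Sum>e | e \<in> support I x \<and> snd e \<noteq> dummy I. job_size I (fst e))"
    unfolding assignment_size_def
    by (rule sum.mono_neutral_cong_right)
      (use support_subset finite_edges in \<open>auto simp: unsplit_support[OF u] intro: unsplit_not_support[OF u]\<close>)
  then show ?thesis by (simp add: sum.reindex[OF inj])
qed

text \<open>The dummy machine is last for every job, so a job off the dummy machine in
  \<open>y\<close> is off it in \<open>x\<close> too.\<close>

lemma assignment_size_mono:
  assumes x: "stable_relaxed_unsplit I x" and y: "stable_relaxed_unsplit I y"
    and pref: "jobs_weakly_prefer I (support I x) (support I y)"
  shows "assignment_size I y \<le> assignment_size I x"
proof -
  note sx = stable_edges_support[OF x] and sy = stable_edges_support[OF y]
  have sub: "fst ` {e \<in> support I y. snd e \<noteq> dummy I} \<subseteq>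
      fst ` {e \<in> support I x. snd e \<noteq> dummy I}"
  proof
    fix j assume "j \<in> fst ` {e \<in> support I y. snd e \<noteq> dummy I}"
    then obtain m where m: "(j, m) \<in> support I y" "m \<noteq> dummy I" by auto
    then have e: "(j, m) \<in> edges I" using stable_edges_subset[OF sy] by auto
    have j: "j \<in> jobs I" using e edgeD by auto
    obtain n where n: "(j, n) \<in> support I x" using stable_edges_assigns[OF sx j] .
    have "n = m \<or> (n, m) \<in> job_pref I j"
      using pref n m unfolding jobs_weakly_prefer_def by blast
    then have "n \<noteq> dummy I"
      using m(2) dummy_last[OF e m(2)] job_pref_asym[OF j] by blast
    then show "j \<in> fst ` {e \<in> support I x. snd e \<noteq> dummy I}" using n by force
  qed
  have fin: "finite (fst ` {e \<in> support I x. snd e \<noteq> dummy I})"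
    using finite_subset[OF stable_edges_subset[OF sx] finite_edges] by auto
  have "0 \<le> job_size I j" if "j \<in> fst ` {e \<in> support I x. snd e \<noteq> dummy I}" for j
    using that stable_edges_subset[OF sx] size_pos edgeD(1) by (force intro: less_imp_le)
  then show ?thesis
    unfolding assignment_size_eq[OF x] assignment_size_eq[OF y]
    by (intro sum_mono2[OF fin sub]) auto
qed

section \<open>Existence of the optimal assignments\<close>

lemma job_optimal_exists: "\<exists>x. job_optimal I x"
proof -
  obtain A where A: "stable_edges I A" "\<And>B. stable_edges I B \<Longrightarrow> jobs_weakly_prefer I A B"
    using best_stable_edges by blast
  have "jobs_weakly_prefer I (support I (unsplit_of I A)) (support I y)"
    if "stable_relaxed_unsplit I y" for y
    using A(2)[OF stable_edges_support[OF that]]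
      support_unsplit_of[OF stable_edges_subset[OF A(1)]] by simp
  then have "job_optimal I (unsplit_of I A)"
    using stable_unsplit_of[OF A(1)] job_weakly_prefers_if unfolding job_optimal_def by blast
  then show ?thesis by blast
qed

text \<open>A single witness, from the greatest fixed point, has both properties. As machine-optimal
  assignments are unique, every one of them is worst for all jobs.\<close>

lemma machine_optimal_job_pessimal_exists:
  "\<exists>x. machine_optimal I x \<and>
    (\<forall>y. stable_relaxed_unsplit I y \<longrightarrow> jobs_weakly_prefer I (support I y) (support I x))"
proof -
  obtain A where A: "stable_edges I A" "\<And>B. stable_edges I B \<Longrightarrow> jobs_weakly_prefer I B A"
    using worst_stable_edges by blast
  have "jobs_weakly_prefer I (support I y) (support I (unsplit_of I A))"
    if "stable_relaxed_unsplit I y" for y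
    using A(2)[OF stable_edges_support[OF that]]
      support_unsplit_of[OF stable_edges_subset[OF A(1)]] by simp
  then show ?thesis
    using stable_unsplit_of[OF A(1)] mach_weakly_prefers_if unfolding machine_optimal_def by blast
qed

end

theorem theorem1:
  fixes I :: "('j, 'm) alloc_inst"
  assumes "valid_inst I"
  shows "(\<exists>!x. job_optimal I x) \<and> (\<exists>!x. machine_optimal I x) \<and>
    (\<forall>x_jopt x_mopt x.
       job_optimal I x_jopt \<longrightarrow> machine_optimal I x_mopt \<longrightarrow> stable_relaxed_unsplit I x \<longrightarrow>
       assignment_size I x_mopt \<le> assignment_size I x \<and>
       assignment_size I x \<le> assignment_size I x_jopt)"
proof -
  interpret allocation I by unfold_locales (rule assms)
  obtain z where z: "machine_optimal I z"
    "\<And>y. stable_relaxed_unsplit I y \<Longrightarrow> jobs_weakly_prefer I (support I y) (support I z)"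
    using machine_optimal_job_pessimal_exists by blast
  have "assignment_size I x_mopt \<le> assignment_size I x \<and>
      assignment_size I x \<le> assignment_size I x_jopt"
    if jo: "job_optimal I x_jopt" and mo: "machine_optimal I x_mopt"
      and x: "stable_relaxed_unsplit I x" for x_jopt x_mopt x
  proof
    have "x_mopt = z" by (rule machine_optimal_unique[OF mo z(1)])
    then show "assignment_size I x_mopt \<le> assignment_size I x"
      using assignment_size_mono[OF x _ z(2)[OF x]] z(1) by (simp add: machine_optimal_def)
    show "assignment_size I x \<le> assignment_size I x_jopt"
      using jo x
      by (intro assignment_size_mono jobs_weakly_prefer_if) (auto simp: job_optimal_def)
  qed
  moreover have "\<exists>!x. job_optimal I x"
    using job_optimal_exists job_optimal_unique by blast
  moreover have "\<exists>!x. machine_optimal I x"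
    using z(1) machine_optimal_unique by blast
  ultimately show ?thesis by blast
qed

end
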